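(* Let $n\ge 1$ and let $E_1|H_1,\ldots,E_{n+1}|H_{n+1}$ be $n+1$ conditional events, with all previsions involved coherently assessed. Let $\mathscr{C}_{1\cdots n}=\bigwedge_{i=1}^n(E_i|H_i)$, $\mathscr{C}_{1\cdots n+1}=\bigwedge_{i=1}^{n+1}(E_i|H_i)$ and $\mathscr{C}_{1\cdots n\,\overline{n+1}}=(E_1|H_1)\wedge\cdots\wedge(E_n|H_n)\wedge(\overline{E}_{n+1}|H_{n+1})$. Then \[ \mathscr{C}_{1\cdots n}=\mathscr{C}_{1\cdots n+1}+\mathscr{C}_{1\cdots n\,\overline{n+1}}. \]
   Context: Events. Events are elements of a Boolean algebra with top $\Omega$ (sure event) and bottom $\emptyset$ (impossible event); one may take subsets of a set $\Omega$. An event is identified with its $0/1$ indicator; $EF$ or $E\wedge F$ is conjunction, $E\vee F$ disjunction, $\overline{E}$ negation. Conditional random quantities. Given an event $H\neq\emptyset$, a random quantity $X$ (a real-valued function on $\Omega$ with finitely many values on $H$) and an assessed real number $\mu=\mathbb{P}(X|H)$ (the conditional prevision), the conditional random quantity $X|H$ is $XH+\mu\overline{H}$ (value $X$ if $H$ is true, $\mu$ if $H$ is false). For a conditional event $E|H$ with $P(E|H)=x$, its indicator (same symbol) is $E|H=EH+x\overline{H}$; it is true, false or void when $EH$, $\overline{E}H$ or $\overline{H}$ is true, respectively. Coherence. A prevision assessment on a family of conditional random quantities is coherent if for every finite subfamily $X_1|H_1,\ldots,X_m|H_m$ with assessed previsions $\mu_1,\ldots,\mu_m$ and all real $s_1,\ldots,s_m$,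 the random gain $G=\sum_{i=1}^m s_iH_i(X_i-\mu_i)$, restricted to $H_1\vee\cdots\vee H_m$, satisfies $\min G\le 0\le\max G$. Conjunction. For a finite family $(A_i|K_i)_{i\in T}$ of conditional events, the conjunctions $\mathscr{C}_S=\bigwedge_{i\in S}(A_i|K_i)$, $\emptyset\ne S\subseteq T$, with assessed previsions $x_S=\mathbb{P}(\mathscr{C}_S)$, are defined recursively on $|S|$ by \[ \mathscr{C}_S=\Big[\bigwedge_{i\in S}A_iK_i+\sum_{\emptyset\neq R\subsetneq S}x_R\Big(\bigwedge_{i\in R}\overline{K}_i\Big)\wedge\Big(\bigwedge_{i\in S\setminus R}A_iK_i\Big)\Big]\Big|\Big(\bigvee_{i\in S}K_i\Big), \] i.e. $\mathscr{C}_S$ has value $1$ if all $A_iK_i$ ($i\in S$) are true; $0$ if some $\overline{A}_iK_i$ is true; $x_R$ if exactly the conditional events with index in $R$ are void and the others are true ($\emptyset\ne R\subsetneq S$); $x_S$ if all $K_i$, $i\in S$, are false. For $S=\{i\}$, $\mathscr{C}_S=A_i|K_i$. Standing assumption. The previsions assessed for all the conditional events and conjunctions involved (including all sub-conjunctions of the families $\{E_1|H_1,\ldots,E_n|H_n,E_{n+1}|H_{n+1}\}$ and $\{E_1|H_1,\ldots,E_n|H_n,\overline{E}_{n+1}|H_{n+1}\}$) form a coherent assessment. Equality of conditional random quantities means equality of values in all cases (as functions on $\Omega$). *)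

theory Defs
  imports Complex_Main "HOL-Library.Indicator_Function"
begin

text \<open>
  The sure event is the universe of an arbitrary type \<open>'w\<close>; events are sets over \<open>'w\<close>, and the
  conditional event \<open>A|K\<close> is given by the two events \<open>A\<close> and \<open>K\<close>. Families are indexed, so that
  repeated members are allowed.
\<close>

definition cond_rq :: "('w \<Rightarrow> real) \<Rightarrow> 'w set \<Rightarrow> real \<Rightarrow> 'w \<Rightarrow> real" where
  "cond_rq X H \<mu> = (\<lambda>w. X w * indicator H w + \<mu> * indicator (- H) w)"

definition gain ::
  "('i \<Rightarrow> 'w \<Rightarrow> real) \<Rightarrow> ('i \<Rightarrow> 'w set) \<Rightarrow> ('i \<Rightarrow> real) \<Rightarrow> ('i \<Rightarrow> real) \<Rightarrow> 'i set \<Rightarrow> 'w \<Rightarrow> real" where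
  "gain X H \<mu> s J w = (\<Sum>j\<in>J. s j * indicator (H j) w * (X j w - \<mu> j))"

text \<open>
  Coherence of the assessment \<open>\<mu> i = \<P>(X i | H i)\<close>, \<open>i \<in> I\<close>. It is meant for nonempty
  conditioning events \<open>H i\<close> and random quantities \<open>X i\<close> with finitely many values on \<open>H i\<close>; the set
  of values of the gain below is then finite and nonempty, so that \<open>Min\<close> and \<open>Max\<close> are meaningful.
\<close>

definition coherent ::
  "'i set \<Rightarrow> ('i \<Rightarrow> 'w \<Rightarrow> real) \<Rightarrow> ('i \<Rightarrow> 'w set) \<Rightarrow> ('i \<Rightarrow> real) \<Rightarrow> bool" where
  "coherent I X H \<mu> \<longleftrightarrow>
     (\<forall>J s. finite J \<and> J \<noteq> {} \<and> J \<subseteq> I \<longrightarrow>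
        Min (gain X H \<mu> s J ` (\<Union>j\<in>J. H j)) \<le> 0 \<and>
        0 \<le> Max (gain X H \<mu> s J ` (\<Union>j\<in>J. H j)))"

text \<open>
  The conjunction of the conditional events \<open>A i | K i\<close>, \<open>i \<in> S\<close>, for finite nonempty \<open>S\<close>.
  Here \<open>x R\<close> is the prevision assessed for the conjunction over \<open>R\<close>. The recursion on the
  cardinality of \<open>S\<close> takes place in the assessment only: the conditioned quantity over \<open>S\<close> uses
  \<open>x R\<close> just for \<open>R \<subset> S\<close>, and \<open>x S\<close> is then assessed for it.
\<close>

definition conj_quantity ::
  "('i \<Rightarrow> 'w set) \<Rightarrow> ('i \<Rightarrow> 'w set) \<Rightarrow> ('i set \<Rightarrow> real) \<Rightarrow> 'i set \<Rightarrow> 'w \<Rightarrow> real" where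
  "conj_quantity A K x S w =
     indicator (\<Inter>i\<in>S. A i \<inter> K i) w +
     (\<Sum>R | R \<noteq> {} \<and> R \<subset> S.
        x R * indicator ((\<Inter>i\<in>R. - K i) \<inter> (\<Inter>i\<in>S - R. A i \<inter> K i)) w)"

definition conj_condition :: "('i \<Rightarrow> 'w set) \<Rightarrow> 'i set \<Rightarrow> 'w set" where
  "conj_condition K S = (\<Union>i\<in>S. K i)"

definition conjunction ::
  "('i \<Rightarrow> 'w set) \<Rightarrow> ('i \<Rightarrow> 'w set) \<Rightarrow> ('i set \<Rightarrow> real) \<Rightarrow> 'i set \<Rightarrow> 'w \<Rightarrow> real" where
  "conjunction A K x S = cond_rq (conj_quantity A K x S) (conj_condition K S) (x S)"

text \<open>
  The two families share their first \<open>n\<close> members, so they are joined into one family indexed by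
  \<open>{1..n+2}\<close>, whose index \<open>n+2\<close> is used for the conditional event with negated \<open>E (n+1)\<close>.
  The sets below index all conjunctions of subfamilies of either family.
\<close>

definition assessed_conjunctions :: "nat \<Rightarrow> nat set set" where
  "assessed_conjunctions n =
     {S. S \<noteq> {} \<and> (S \<subseteq> {1..n+1} \<or> S \<subseteq> insert (n+2) {1..n})}"

end

theory Submission imports Defs begin

text \<open>
  At an outcome \<open>w\<close> where no member of a nonempty family is false, the conjunction takes the value
  \<open>x V\<close>, with \<open>V\<close> the set of the members that are void at \<open>w\<close>, provided that \<open>x {}\<close> is read as
  \<open>1\<close>, the value of an empty conjunction (\<open>conjunction_eq_conj_value\<close>). With this
  convention, add to a family \<open>T\<close> either a conditional event, with index \<open>a\<close>, or its negation, with
  index \<open>b\<close>. If the added event is not void, one of the two extended conjunctions vanishes and the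
  other equals the conjunction over \<open>T\<close>. If it is void, the two extended conjunctions have the
  values \<open>x (V \<union> {a})\<close> and \<open>x (V \<union> {b})\<close>. So the identity of random quantities reduces to
  the additivity \<open>x V = x (V \<union> {a}) + x (V \<union> {b})\<close> of the previsions.

  Additivity is what coherence enforces, by induction on \<open>V\<close>
  (\<open>coherent_prevision_additive\<close>). Bet \<open>1\<close> on the conjunction over \<open>V\<close> and \<open>- 1\<close> on each of the
  two extensions. Unless all bets are called off, either the added event is not void or the void
  part of \<open>V\<close> is a proper subset of \<open>V\<close>, for which additivity is known; in both cases the pay-offs
  cancel. The gain is therefore constant, and coherence forces a constant gain to be \<open>0\<close>
  (\<open>coherent_linear_relation\<close>).
\<close>

text \<open>
  A bet that is called off contributes \<open>0\<close> to the gain, and there \<open>X|H\<close> equals its prevision. The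
  gain is thus a combination of the differences between the conditional random quantities and their
  previsions, without any reference to the conditioning events.
\<close>

lemma gain_eq_sum_cond_rq:
  "gain X H \<mu> s J w = (\<Sum>j\<in>J. s j * (cond_rq (X j) (H j) (\<mu> j) w - \<mu> j))"
  unfolding gain_def cond_rq_def
  by (intro sum.cong refl) (auto simp: indicator_def)

text \<open>
  If a linear combination is constant wherever some bet is in force, then so is the
  gain, whose minimum and maximum then coincide.
\<close>

lemma coherent_linear_relation:
  assumes coh: "coherent I X H \<mu>" and J: "finite J" "J \<subseteq> I"
    and ne: "(\<Union>j\<in>J. H j) \<noteq> {}"
    and const: "\<And>w. w \<in> (\<Union>j\<in>J. H j) \<Longrightarrow> (\<Sum>j\<in>J. s j * cond_rq (X j) (H j) (\<mu> j) w) = c"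
  shows "(\<Sum>j\<in>J. s j * \<mu> j) = c"
proof -
  let ?d = "c - (\<Sum>j\<in>J. s j * \<mu> j)"
  have "gain X H \<mu> s J w = ?d" if "w \<in> (\<Union>j\<in>J. H j)" for w
    using const[OF that] by (simp add: gain_eq_sum_cond_rq right_diff_distrib sum_subtractf)
  then have "gain X H \<mu> s J ` (\<Union>j\<in>J. H j) = {?d}"
    using ne by (auto simp: image_iff)
  moreover have "Min (gain X H \<mu> s J ` (\<Union>j\<in>J. H j)) \<le> 0 \<and>
      0 \<le> Max (gain X H \<mu> s J ` (\<Union>j\<in>J. H j))"
    using coh J ne unfolding coherent_def by blast
  ultimately show ?thesis by simp
qed

definition conj_value ::
  "('i \<Rightarrow> 'w set) \<Rightarrow> ('i \<Rightarrow> 'w set) \<Rightarrow> ('i set \<Rightarrow> real) \<Rightarrow> 'i set \<Rightarrow> 'w \<Rightarrow> real" where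
  "conj_value A K y S w =
     (if \<exists>i\<in>S. w \<in> K i - A i then 0 else y {i \<in> S. w \<notin> K i})"

text \<open>
  Of the events indexed by \<open>R\<close> in the definition of the conjunction at most one occurs at \<open>w\<close>: the
  one for which \<open>R\<close> is exactly the set of void members. The update \<open>x({} := 1)\<close> supplies the value
  \<open>1\<close> for the case that nothing is void, which the definition treats by a separate summand.
\<close>

lemma conjunction_eq_conj_value:
  assumes fin: "finite S" and ne: "S \<noteq> {}"
  shows "conjunction A K x S w = conj_value A K (x({} := 1)) S w"
proof -
  define V where "V = {i \<in> S. w \<notin> K i}"
  have ev: "w \<in> (\<Inter>i\<in>R. - K i) \<inter> (\<Inter>i\<in>S - R. A i \<inter> K i) \<longleftrightarrow>
      R = V \<and> \<not> (\<exists>i\<in>S. w \<in> K i - A i)" if "R \<subseteq> S" for R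
    using that unfolding V_def by auto
  have all: "w \<in> (\<Inter>i\<in>S. A i \<inter> K i) \<longleftrightarrow> V = {} \<and> \<not> (\<exists>i\<in>S. w \<in> K i - A i)"
    unfolding V_def by auto
  have finR: "finite {R. R \<noteq> {} \<and> R \<subset> S}"
    by (rule finite_subset[of _ "Pow S"]) (use fin in auto)
  have "(\<Sum>R | R \<noteq> {} \<and> R \<subset> S.
        x R * indicator ((\<Inter>i\<in>R. - K i) \<inter> (\<Inter>i\<in>S - R. A i \<inter> K i)) w) =
      (\<Sum>R | R \<noteq> {} \<and> R \<subset> S.
        if R = V then (if \<exists>i\<in>S. w \<in> K i - A i then 0 else x R) else 0)"
    using ev by (intro sum.cong refl) (simp add: indicator_def less_le)
  also have "\<dots> = (if V \<noteq> {} \<and> V \<subset> S then (if \<exists>i\<in>S. w \<in> K i - A i then 0 else x V) else 0)"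
    using finR by simp
  finally have q: "conj_quantity A K x S w =
      (if V = {} \<and> \<not> (\<exists>i\<in>S. w \<in> K i - A i) then 1 else 0) +
      (if V \<noteq> {} \<and> V \<subset> S then (if \<exists>i\<in>S. w \<in> K i - A i then 0 else x V) else 0)"
    unfolding conj_quantity_def using all by (simp add: indicator_def)
  have VS: "V \<subset> S \<longleftrightarrow> w \<in> conj_condition K S"
    unfolding V_def conj_condition_def by auto
  have "V = S \<and> \<not> (\<exists>i\<in>S. w \<in> K i - A i)" if "w \<notin> conj_condition K S"
    using that unfolding V_def conj_condition_def by auto
  then show ?thesis
    using q VS ne unfolding conjunction_def cond_rq_def conj_value_def V_def[symmetric]
    by (auto simp: indicator_def)
qed

text \<open>
  Additivity of the previsions matters only where the added conditional event is void, and
  only for the void part of the family.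
\<close>

lemma conj_value_additive:
  assumes "a \<notin> S" "b \<notin> S"
    and neg: "A b = - A a" "K b = K a"
    and add: "w \<notin> K a \<Longrightarrow>
      y {i \<in> S. w \<notin> K i} = y (insert a {i \<in> S. w \<notin> K i}) + y (insert b {i \<in> S. w \<notin> K i})"
  shows "conj_value A K y S w =
    conj_value A K y (insert a S) w + conj_value A K y (insert b S) w"
proof (cases "w \<in> K a")
  case True
  then have "{i \<in> insert c S. w \<notin> K i} = {i \<in> S. w \<notin> K i}" if "c \<in> {a, b}" for c
    using that neg by auto
  then show ?thesis using True neg by (auto simp: conj_value_def)
next
  case False
  then have "{i \<in> insert c S. w \<notin> K i} = insert c {i \<in> S. w \<notin> K i}" if "c \<in> {a, b}" for c
    using that neg by auto
  then show ?thesis using False neg add by (auto simp: conj_value_def)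
qed

text \<open>
  The induction starts at the empty set, where the statement says that the previsions of a
  conditional event and its negation add up to \<open>1\<close>.
\<close>

lemma coherent_prevision_additive:
  fixes A K :: "'i \<Rightarrow> 'w set" and x :: "'i set \<Rightarrow> real"
  assumes coh: "coherent I (conj_quantity A K x) (conj_condition K) x"
    and I: "\<And>S. S \<noteq> {} \<Longrightarrow> S \<subseteq> insert a T \<or> S \<subseteq> insert b T \<Longrightarrow> S \<in> I"
    and T: "finite T" "a \<notin> T" "b \<notin> T" and ab: "a \<noteq> b"
    and neg: "A b = - A a" "K b = K a" and Ka: "K a \<noteq> {}"
    and V: "V \<subseteq> T"
  defines "y \<equiv> x({} := 1)"
  shows "y V = y (insert a V) + y (insert b V)"
proof -
  have "finite V" using V T(1) by (rule finite_subset)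
  then show ?thesis using V
  proof (induction V rule: finite_psubset_induct)
    case (psubset V)
    define J where "J = {V, insert a V, insert b V} - {{}}"
    define s where "s R = (if R = V then 1 else - 1 :: real)" for R
    have notin: "a \<notin> V" "b \<notin> V" using psubset.prems T by auto
    then have dist: "insert a V \<noteq> V" "insert b V \<noteq> V" "insert a V \<noteq> insert b V"
      using ab by auto
    have val: "conjunction A K x R w = conj_value A K y R w" if "R \<in> J" for R w
      unfolding y_def using that psubset.hyps
      by (intro conjunction_eq_conj_value) (auto simp: J_def)
    have JI: "J \<subseteq> I" using psubset.prems by (auto simp: J_def intro!: I)
    have cond: "(\<Union>R\<in>J. conj_condition K R) = (\<Union>i\<in>insert a V. K i)"
      unfolding J_def conj_condition_def using neg(2)
      by (cases "V = {}") (simp_all add: insert_Diff_if Un_left_commute)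
    \<comment> \<open>The constant is \<open>0\<close>, except for empty \<open>V\<close>: then no bet is placed on \<open>V\<close> itself,
      and the value \<open>1\<close> of the empty conjunction moves to the other side.\<close>
    have "(\<Sum>R\<in>J. s R * x R) = (if V = {} then - 1 else 0)"
    proof (rule coherent_linear_relation[OF coh])
      show "finite J" by (simp add: J_def)
      show "J \<subseteq> I" by (rule JI)
      show "(\<Union>R\<in>J. conj_condition K R) \<noteq> {}" using cond Ka by auto
      fix w assume "w \<in> (\<Union>R\<in>J. conj_condition K R)"
      then have w: "w \<in> K a \<or> (\<exists>i\<in>V. w \<in> K i)" using cond by auto
      have "conj_value A K y V w =
          conj_value A K y (insert a V) w + conj_value A K y (insert b V) w"
      proof (rule conj_value_additive[OF notin neg])
        assume "w \<notin> K a"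
        then have "{i \<in> V. w \<notin> K i} \<subset> V" using w by auto
        then show "y {i \<in> V. w \<notin> K i} =
            y (insert a {i \<in> V. w \<notin> K i}) + y (insert b {i \<in> V. w \<notin> K i})"
          using psubset.prems by (intro psubset.IH) auto
      qed
      moreover have "conj_value A K y {} w = 1"
        by (simp add: conj_value_def y_def)
      moreover have "(\<Sum>R\<in>J. s R * conjunction A K x R w) = (\<Sum>R\<in>J. s R * conj_value A K y R w)"
        using val by (intro sum.cong) auto
      ultimately show "(\<Sum>R\<in>J. s R * cond_rq (conj_quantity A K x R) (conj_condition K R) (x R) w) =
          (if V = {} then - 1 else 0)"
        unfolding conjunction_def[symmetric]
        using dist by (cases "V = {}") (auto simp: J_def s_def)
    qed
    then show ?case
      using dist by (cases "V = {}") (auto simp: J_def s_def y_def)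
  qed
qed

theorem theorem8:
  fixes n :: nat and E H :: "nat \<Rightarrow> 'w set" and x :: "nat set \<Rightarrow> real"
  assumes "n \<ge> 1"
    and "\<forall>i\<in>{1..n+1}. H i \<noteq> {}"
    and "E (n+2) = - E (n+1)"
    and "H (n+2) = H (n+1)"
    and "coherent (assessed_conjunctions n) (conj_quantity E H x) (conj_condition H) x"
  shows "conjunction E H x {1..n} =
    (\<lambda>w. conjunction E H x {1..n+1} w + conjunction E H x (insert (n+2) {1..n}) w)"
proof
  fix w
  define y where "y = x({} := 1)"
  have ins: "{1..n+1} = insert (n+1) {1..n}" by auto
  have add: "y V = y (insert (n+1) V) + y (insert (n+2) V)" if "V \<subseteq> {1..n}" for V
    unfolding y_def
  proof (rule coherent_prevision_additive[OF assms(5) _ _ _ _ _ assms(3,4) _ that])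
    show "S \<in> assessed_conjunctions n"
      if "S \<noteq> {}" "S \<subseteq> insert (n+1) {1..n} \<or> S \<subseteq> insert (n+2) {1..n}" for S
      using that unfolding assessed_conjunctions_def ins by blast
    show "H (n+1) \<noteq> {}" using assms(2) by simp
  qed auto
  have "conj_value E H y {1..n} w =
      conj_value E H y (insert (n+1) {1..n}) w + conj_value E H y (insert (n+2) {1..n}) w"
    by (rule conj_value_additive[OF _ _ assms(3,4) add]) auto
  then show "conjunction E H x {1..n} w =
      conjunction E H x {1..n+1} w + conjunction E H x (insert (n+2) {1..n}) w"
    using assms(1) unfolding y_def ins by (simp add: conjunction_eq_conj_value)
qed

end
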